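(* Let $p$ be an odd prime. Let $A=(a_1,\dots,a_N)$ be a zero-sum-free sequence over $V=\mathbb F_p^2$, and let $H\le V$ be a line. Then $$|\Sigma_0(A)\cap H|\ge N-p+2.$$ (No condition on which terms of $A$ lie in $H$ is required.)
   Context: A sequence over an abelian group is a finite list of elements, with repetitions allowed and order irrelevant (a finite multiset). A line is a one-dimensional linear subspace of $\mathbb F_p^2$. For a sequence $A$ in an abelian group, $\Sigma_0(A)$ is the set of all sums of subsequences of $A$, including the empty sum $0$. A sequence is zero-sum-free if no nonempty subsequence has sum zero. *)

theory Defs
  imports "HOL-Analysis.Cartesian_Space" "HOL-Library.Multiset"
    "Berlekamp_Zassenhaus.Finite_Field"
begin

definition Sigma0 :: "'a::comm_monoid_add multiset \<Rightarrow> 'a set" where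
  "Sigma0 A = {sum_mset B | B. B \<subseteq># A}"

definition zero_sum_free :: "'a::comm_monoid_add multiset \<Rightarrow> bool" where
  "zero_sum_free A \<longleftrightarrow> (\<forall>B. B \<subseteq># A \<and> B \<noteq> {#} \<longrightarrow> sum_mset B \<noteq> 0)"

(* vec.subspace and vec.dim refer to the vector space over the coordinate field 'a,
   not to the real vector space structure used by plain subspace and dim. *)
definition is_line :: "('a::field ^ 2) set \<Rightarrow> bool" where
  "is_line H \<longleftrightarrow> vec.subspace H \<and> vec.dim H = 1"

end

theory Submission
  imports Defs
begin

text \<open>
  The proof is the polynomial method. Suppose that \<open>f\<close> is a function on an abelian group \<open>V\<close> which
  is killed by any \<open>n\<close> successive difference operators, as a polynomial of degree less than \<open>n\<close> is.
  For a sequence \<open>A\<close> of length \<open>n\<close>, the iterated difference of \<open>f\<close> at \<open>0\<close> in the directions of \<open>A\<close> is the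
  signed sum of the values of \<open>f\<close> over all subsequence sums of \<open>A\<close>, and it is \<open>0\<close>. If \<open>f 0 \<noteq> 0\<close>, then
  \<open>f\<close> is therefore nonzero at the sum of some nonempty subsequence
  (\<open>exists_nonzero_at_subsequence_sum\<close>).

  For \<open>V = F\<^sub>p\<^sup>2\<close> let \<open>L\<close> be a linear form with kernel \<open>H\<close> and \<open>S = \<Sigma>\<^sub>0(A) \<inter> H\<close>. The polynomial
  \<open>\<Prod>\<^bsub>c \<noteq> 0\<^esub> (L v - c)\<close>, of degree \<open>p - 1\<close>, is nonzero on \<open>H\<close> and zero elsewhere. Multiply it, for
  each \<open>s \<in> S - {0}\<close>, by an affine form that vanishes at \<open>s\<close> but not at \<open>0\<close>. The resulting
  polynomial, of degree \<open>p + |S| - 2\<close>, is nonzero at \<open>0\<close> but zero at every other element of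
  \<open>\<Sigma>\<^sub>0(A)\<close>. Since \<open>A\<close> is zero-sum-free, all its nonempty subsequence sums are among these zeros.
  So the degree is at least \<open>N\<close>, which is the claim.
\<close>

text \<open>
  This stands in for ``polynomial of degree less than \<open>n\<close>'', and \<open>n = 0\<close> leaves only the zero
  function. It makes sense on any abelian group, and it is exactly the form in which the degree is
  used: one difference for each term of the sequence.
\<close>

primrec degree_less :: "nat \<Rightarrow> ('v::ab_group_add \<Rightarrow> 'r::comm_ring_1) \<Rightarrow> bool" where
  "degree_less 0 f \<longleftrightarrow> (\<forall>v. f v = 0)"
| "degree_less (Suc n) f \<longleftrightarrow> (\<forall>a. degree_less n (\<lambda>v. f v - f (v + a)))"

lemma degree_less_diff:
  "degree_less n f \<Longrightarrow> degree_less n g \<Longrightarrow> degree_less n (\<lambda>v. f v - g v)"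
proof (induction n arbitrary: f g)
  case (Suc n)
  show ?case
  proof (simp, rule allI)
    fix a
    have "degree_less n (\<lambda>v. (f v - f (v + a)) - (g v - g (v + a)))"
      by (rule Suc.IH) (use Suc.prems in auto)
    then show "degree_less n (\<lambda>v. f v - g v - (f (v + a) - g (v + a)))"
      by (simp add: algebra_simps)
  qed
qed auto

lemma degree_less_scale: "degree_less n f \<Longrightarrow> degree_less n (\<lambda>v. c * f v)"
proof (induction n arbitrary: f)
  case (Suc n)
  then show ?case by (simp flip: right_diff_distrib)
qed auto

lemma degree_less_translate: "degree_less n f \<Longrightarrow> degree_less n (\<lambda>v. f (v + b))"
proof (induction n arbitrary: f)
  case (Suc n)
  show ?case
  proof (simp, rule allI)
    fix a
    have "degree_less n (\<lambda>v. f v - f (v + a))"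
      using Suc.prems by simp
    from Suc.IH[OF this] show "degree_less n (\<lambda>v. f (v + b) - f (v + a + b))"
      by (simp add: ac_simps)
  qed
qed auto

lemma degree_less_Suc: "degree_less n f \<Longrightarrow> degree_less (Suc n) f"
proof (induction n arbitrary: f)
  case (Suc n)
  then show ?case by (metis degree_less.simps(2))
qed auto

lemma degree_less_mono: "m \<le> n \<Longrightarrow> degree_less m f \<Longrightarrow> degree_less n f"
  by (induction rule: dec_induct) (use degree_less_Suc in blast)+

text \<open>
  The reason is the Leibniz rule: the difference of \<open>(l - c) g\<close> in direction \<open>a\<close> is \<open>l - c\<close> times
  the difference of \<open>g\<close>, minus the constant \<open>l a\<close> times a translate of \<open>g\<close>.
\<close>

lemma degree_less_affine_mult:
  assumes "\<And>u v. l (u + v) = l u + l v" and "degree_less n g"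
  shows "degree_less (Suc n) (\<lambda>v. (l v - c) * g v)"
  using assms(2)
proof (induction n arbitrary: g)
  case 0
  then show ?case by simp
next
  case (Suc n)
  have "degree_less (Suc n) (\<lambda>v. (l v - c) * g v - (l (v + a) - c) * g (v + a))" for a
  proof -
    have "degree_less (Suc n) (\<lambda>v. (l v - c) * (g v - g (v + a)))"
      using Suc.prems by (intro Suc.IH) simp
    moreover have "degree_less (Suc n) (\<lambda>v. l a * g (v + a))"
      by (intro degree_less_scale degree_less_translate Suc.prems)
    ultimately have
      "degree_less (Suc n) (\<lambda>v. (l v - c) * (g v - g (v + a)) - l a * g (v + a))"
      by (rule degree_less_diff)
    moreover have "(\<lambda>v. (l v - c) * (g v - g (v + a)) - l a * g (v + a)) =
        (\<lambda>v. (l v - c) * g v - (l (v + a) - c) * g (v + a))"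
      by (simp add: assms(1) algebra_simps)
    ultimately show ?thesis by simp
  qed
  then show ?case
    by (subst degree_less.simps(2)) blast
qed

lemma degree_less_prod_affine_mult:
  assumes "finite I" and "\<And>i u v. i \<in> I \<Longrightarrow> l i (u + v) = l i u + l i v"
    and "degree_less n g"
  shows "degree_less (card I + n) (\<lambda>v. (\<Prod>i\<in>I. l i v - c i) * g v)"
  using assms(1,2)
proof (induction I)
  case empty
  then show ?case using assms(3) by simp
next
  case (insert i I)
  have "degree_less (card I + n) (\<lambda>v. (\<Prod>i\<in>I. l i v - c i) * g v)"
    using insert by simp
  from degree_less_affine_mult[of "l i", OF _ this, of "c i"] show ?case
    using insert by (simp add: mult.assoc del: degree_less.simps)
qed

text \<open>
  If \<open>f\<close> vanished at \<open>v + sum_mset B\<close> for every nonempty \<open>B\<close>, then so would its difference in the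
  direction of a term \<open>a\<close>, at the nonempty sums of the remaining terms, while at
  \<open>v\<close> itself this difference would be \<open>f v - f (v + a) = f v\<close>. So removing the terms of \<open>A\<close> one at a time preserves the value at \<open>v\<close>,
  and after \<open>size A\<close> steps nothing but \<open>0\<close> is left.
\<close>

lemma exists_nonzero_at_subsequence_sum:
  assumes "degree_less (size A) f" and "f v \<noteq> 0"
  shows "\<exists>B. B \<subseteq># A \<and> B \<noteq> {#} \<and> f (v + sum_mset B) \<noteq> 0"
  using assms
proof (induction A arbitrary: f)
  case empty
  then show ?case by simp
next
  case (add a A)
  show ?case
  proof (rule ccontr)
    assume "\<not> ?case"
    then have zero: "f (v + sum_mset B) = 0" if "B \<subseteq># add_mset a A" "B \<noteq> {#}" for B
      using that by blast
    let ?g = "\<lambda>v. f v - f (v + a)"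
    have "f (v + a) = 0"
      using zero[of "{#a#}"] by simp
    then have "?g v \<noteq> 0" and "degree_less (size A) ?g"
      using add.prems by auto
    with add.IH obtain B where B: "B \<subseteq># A" "B \<noteq> {#}" "?g (v + sum_mset B) \<noteq> 0"
      by blast
    have "B \<subseteq># add_mset a A"
      using B(1) by (rule subset_mset.order_trans) (auto simp: subseteq_mset_def)
    moreover have "f (v + sum_mset (add_mset a B)) = 0"
      using B(1) by (intro zero) auto
    ultimately show False
      using B(2,3) zero[of B] by (simp add: ac_simps)
  qed
qed

lemma line_eq_kernel:
  fixes H :: "('a::field ^ 2) set"
  assumes "is_line H"
  obtains L :: "'a ^ 2 \<Rightarrow> 'a"
  where "\<And>u v. L (u + v) = L u + L v" and "\<And>v. L v = 0 \<longleftrightarrow> v \<in> H"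
proof -
  have H: "vec.subspace H" "vec.dim H = 1"
    using assms by (auto simp: is_line_def)
  obtain B where B: "B \<subseteq> H" "vec.independent B" "H \<subseteq> vec.span B" "card B = vec.dim H"
    using vec.basis_exists by blast
  then obtain b where "B = {b}"
    using H(2) by (metis card_1_singletonE)
  with B H(1) have b: "b \<noteq> 0" "H = vec.span {b}"
    using vec.dependent_zero by (blast, metis vec.span_minimal subset_antisym)
  have H_eq: "H = range (\<lambda>k. k *s b)"
    using b(2) vec.span_singleton by blast
  \<comment> \<open>The determinant of the matrix with columns \<open>v\<close> and \<open>b\<close>.\<close>
  let ?L = "\<lambda>v::'a ^ 2. v $ 1 * b $ 2 - v $ 2 * b $ 1"
  have "v \<in> H" if "?L v = 0" for v
  proof (cases "b $ 1 = 0")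
    case True
    with b(1) have "b $ 2 \<noteq> 0"
      by (auto simp: vec_eq_iff forall_2)
    with True that have "v = (v $ 2 / b $ 2) *s b"
      by (auto simp: vec_eq_iff forall_2)
    then show ?thesis using H_eq by blast
  next
    case False
    with that have "v = (v $ 1 / b $ 1) *s b"
      by (auto simp: vec_eq_iff forall_2 field_simps)
    then show ?thesis using H_eq by blast
  qed
  moreover have "?L v = 0" if "v \<in> H" for v
    using that by (auto simp: H_eq)
  ultimately show ?thesis
    by (intro that[of ?L]) (auto simp: algebra_simps)
qed

theorem theorem4p1:
  fixes A :: "('p::prime_card mod_ring ^ 2) multiset"
    and H :: "('p mod_ring ^ 2) set"
    and p N :: nat
  assumes "CARD('p) = p"
    and "prime p" and "odd p"
    and "size A = N"
    and "zero_sum_free A"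
    and "is_line H"
  shows "int (card (Sigma0 A \<inter> H)) \<ge> int N - int p + 2"
proof (rule ccontr)
  assume less: "\<not> ?thesis"
  let ?S = "Sigma0 A \<inter> H"
  have "0 \<in> H"
    using assms(6) by (simp add: is_line_def vec.subspace_0)
  moreover have "0 \<in> Sigma0 A"
    unfolding Sigma0_def by (auto intro: exI[of _ "{#}"])
  ultimately have card_S: "card (?S - {0}) + 1 = card ?S"
    using card.remove[of ?S 0] by simp
  obtain L :: "'p mod_ring ^ 2 \<Rightarrow> 'p mod_ring"
    where L: "\<And>u v. L (u + v) = L u + L v" "\<And>v. L v = 0 \<longleftrightarrow> v \<in> H"
    using line_eq_kernel[OF assms(6)] by blast
  have "\<forall>s::'p mod_ring ^ 2. \<exists>i. s \<noteq> 0 \<longrightarrow> s $ i \<noteq> 0"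
    by (auto simp: vec_eq_iff)
  then obtain i where i: "\<And>s::'p mod_ring ^ 2. s \<noteq> 0 \<Longrightarrow> s $ i s \<noteq> 0"
    by metis
  \<comment> \<open>The final factor \<open>1\<close>, of degree less than \<open>1\<close>, is where the count of affine factors starts.\<close>
  define f where "f v =
    (\<Prod>c\<in>UNIV - {0}. L v - c) * ((\<Prod>s\<in>?S - {0}. v $ i s - s $ i s) * 1)" for v
  have "degree_less (card (UNIV - {0::'p mod_ring}) + (card (?S - {0}) + 1)) f"
    unfolding f_def by (intro degree_less_prod_affine_mult) (auto simp: L(1))
  moreover have "card (UNIV - {0::'p mod_ring}) + 1 = p"
    using assms(1,2) by (simp add: card_Diff_singleton prime_gt_0_nat)
  ultimately have "degree_less (size A) f"
    using less card_S assms(4) by (elim degree_less_mono[rotated]) linarith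
  moreover have "f 0 \<noteq> 0"
    using i L(2)[of 0] \<open>0 \<in> H\<close> by (auto simp: f_def)
  ultimately obtain B where B: "B \<subseteq># A" "B \<noteq> {#}" "f (sum_mset B) \<noteq> 0"
    using exists_nonzero_at_subsequence_sum[of A f 0] by auto
  have "sum_mset B \<noteq> 0"
    using B assms(5) by (auto simp: zero_sum_free_def)
  moreover have "sum_mset B \<in> Sigma0 A"
    using B(1) by (auto simp: Sigma0_def)
  moreover have "sum_mset B \<in> H"
    \<comment> \<open>Otherwise the factor for \<open>c = L (sum_mset B)\<close> vanishes.\<close>
    using B(3) L(2)[of "sum_mset B"] by (auto simp: f_def)
  ultimately show False
    using B(3) by (auto simp: f_def)
qed

end
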